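(* Let $I$ be a set of unary connectives with $I\cap\mathcal{L}=\emptyset$, let $\mathbf{L}$ be an axiomatic extension of $\mathbf{Ł}(I)$ algebraized by a subvariety $\mathsf V$ of $\mathsf{MV}(I)$, and let $\Gamma\cup\Delta\cup\{\psi\}$ be a set of $\mathcal{L}(I)$-formulas. Then $\Gamma,\Delta\vdash_{\mathbf L}\psi$ if and only if there exist $n\ge 0$, I-blocks $M_1,\dots,M_n$ and $\psi_1,\dots,\psi_n\in\Delta$ such that $\Gamma\vdash_{\mathbf L}\prod_{j=1}^n M_j(\psi_j)\to\psi$.
   Context: $\mathcal{L}$ has binary connectives $\wedge,\vee,\cdot,\to$ and constants $0,1$; $\mathcal{L}(I)=\mathcal{L}\cup I$; $\varphi\leftrightarrow\psi$ abbreviates $(\varphi\to\psi)\wedge(\psi\to\varphi)$, $\neg\varphi$ abbreviates $\varphi\to0$. $\mathbf{Ł}(I)$ is the logic over $\mathcal{L}(I)$ with axiom schemes (A1) $\varphi\to\varphi$; (A2) $(\varphi\to\psi)\to((\psi\to\chi)\to(\varphi\to\chi))$; (A3) $(\varphi\cdot\psi)\to(\psi\cdot\varphi)$; (A4) $(\varphi\cdot\psi)\to\psi$; (A5) $(\varphi\to(\psi\to\chi))\to((\varphi\cdot\psi)\to\chi)$; (A6) $((\varphi\cdot\psi)\to\chi)\to(\varphi\to(\psi\to\chi))$; (A7) $(\varphi\cdot(\varphi\to\psi))\to(\varphi\wedge\psi)$; (A8) $(\varphi\wedge\psi)\to(\varphi\cdot(\varphi\to\psi))$; (A9) $(\varphi\wedge\psi)\to(\psi\wedge\varphi)$;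 (A10) $\varphi\to(\varphi\vee\psi)$; (A11) $\psi\to(\varphi\vee\psi)$; (A12) $((\varphi\to\psi)\wedge(\chi\to\psi))\to((\varphi\vee\chi)\to\psi)$; (A13) $0\to\varphi$; (A14) $(\varphi\to\psi)\vee(\psi\to\varphi)$; (A15) $\neg\neg\varphi\leftrightarrow\varphi$; and for each $\Box\in I$: $\Box(\varphi\to\psi)\to(\Box\varphi\to\Box\psi)$, $\Box(\varphi\cdot\psi)\leftrightarrow\Box\varphi\cdot\Box\psi$, $\Box(\varphi\wedge\psi)\leftrightarrow\Box\varphi\wedge\Box\psi$, $\Box1\leftrightarrow1$, $\Box0\leftrightarrow0$; rules modus ponens $\varphi,\varphi\to\psi\vdash\psi$ and necessitation $\varphi\vdash\Box\varphi$ for each $\Box\in I$. An axiomatic extension adds axiom schemes. $\mathsf{MV}(I)$ is the variety of MV-algebras expanded by unary operations $\Box\in I$, each a $\{\wedge,\cdot,0,1\}$-endomorphism. An I-block is a nonempty finite word in the alphabet $I$, applied to a formula by successive application of its letters. The empty product ($n=0$) is $1$.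
   Formalization: I-blocks are allowed to be the empty word (M(φ)=φ); with only nonempty words the claim is false, e.g. for I=∅, Γ=∅, Δ={p}, ψ=p, where p ⊢ p holds but there are no blocks and 1→p is not a theorem. *)

theory Defs
  imports "HOL-Library.FuncSet"
begin

text \<open>The propositional variables are indexed by \<^typ>\<open>nat\<close>. The modal connectives form a set
  \<open>I\<close> over the type \<^typ>\<open>'i\<close>, possibly empty; being arguments of the constructor \<open>Box\<close>, they are
  automatically distinct from the connectives of the base language.\<close>

datatype 'i fm =
    Var nat
  | Zero
  | One
  | Conj "'i fm" "'i fm" (infixr \<open>\<^bold>\<and>\<close> 57)
  | Disj "'i fm" "'i fm" (infixr \<open>\<^bold>\<or>\<close> 56)
  | Fuse "'i fm" "'i fm" (infixr \<open>\<^bold>\<cdot>\<close> 58)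
  | Imp "'i fm" "'i fm" (infixr \<open>\<^bold>\<rightarrow>\<close> 55)
  | Box 'i "'i fm"

definition Iff :: "'i fm \<Rightarrow> 'i fm \<Rightarrow> 'i fm" (infix \<open>\<^bold>\<leftrightarrow>\<close> 54) where
  "\<phi> \<^bold>\<leftrightarrow> \<psi> = (\<phi> \<^bold>\<rightarrow> \<psi>) \<^bold>\<and> (\<psi> \<^bold>\<rightarrow> \<phi>)"

definition Neg :: "'i fm \<Rightarrow> 'i fm" (\<open>\<^bold>\<not> _\<close> [60] 60) where
  "\<^bold>\<not> \<phi> = (\<phi> \<^bold>\<rightarrow> Zero)"

primrec vars :: "'i fm \<Rightarrow> nat set" where
  "vars (Var n) = {n}"
| "vars Zero = {}"
| "vars One = {}"
| "vars (\<phi> \<^bold>\<and> \<psi>) = vars \<phi> \<union> vars \<psi>"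
| "vars (\<phi> \<^bold>\<or> \<psi>) = vars \<phi> \<union> vars \<psi>"
| "vars (\<phi> \<^bold>\<cdot> \<psi>) = vars \<phi> \<union> vars \<psi>"
| "vars (\<phi> \<^bold>\<rightarrow> \<psi>) = vars \<phi> \<union> vars \<psi>"
| "vars (Box i \<phi>) = vars \<phi>"

definition formulas :: "'i set \<Rightarrow> 'i fm set" where
  "formulas I = {\<phi>. set_fm \<phi> \<subseteq> I}"

primrec subst :: "(nat \<Rightarrow> 'i fm) \<Rightarrow> 'i fm \<Rightarrow> 'i fm" where
  "subst \<sigma> (Var n) = \<sigma> n"
| "subst \<sigma> Zero = Zero"
| "subst \<sigma> One = One"
| "subst \<sigma> (\<phi> \<^bold>\<and> \<psi>) = subst \<sigma> \<phi> \<^bold>\<and> subst \<sigma> \<psi>"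
| "subst \<sigma> (\<phi> \<^bold>\<or> \<psi>) = subst \<sigma> \<phi> \<^bold>\<or> subst \<sigma> \<psi>"
| "subst \<sigma> (\<phi> \<^bold>\<cdot> \<psi>) = subst \<sigma> \<phi> \<^bold>\<cdot> subst \<sigma> \<psi>"
| "subst \<sigma> (\<phi> \<^bold>\<rightarrow> \<psi>) = (subst \<sigma> \<phi> \<^bold>\<rightarrow> subst \<sigma> \<psi>)"
| "subst \<sigma> (Box i \<phi>) = Box i (subst \<sigma> \<phi>)"

text \<open>The only scheme mentioning the constant \<open>1\<close> is \<open>Box_One\<close>, so \<open>1\<close> is not derivable from these
  schemes alone. It is derivable in every extension algebraized by a subvariety of \<open>MV(I)\<close>.\<close>

inductive luk_axiom :: "'i fm \<Rightarrow> bool" where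
  A1: "luk_axiom (\<phi> \<^bold>\<rightarrow> \<phi>)"
| A2: "luk_axiom ((\<phi> \<^bold>\<rightarrow> \<psi>) \<^bold>\<rightarrow> ((\<psi> \<^bold>\<rightarrow> \<chi>) \<^bold>\<rightarrow> (\<phi> \<^bold>\<rightarrow> \<chi>)))"
| A3: "luk_axiom ((\<phi> \<^bold>\<cdot> \<psi>) \<^bold>\<rightarrow> (\<psi> \<^bold>\<cdot> \<phi>))"
| A4: "luk_axiom ((\<phi> \<^bold>\<cdot> \<psi>) \<^bold>\<rightarrow> \<psi>)"
| A5: "luk_axiom ((\<phi> \<^bold>\<rightarrow> (\<psi> \<^bold>\<rightarrow> \<chi>)) \<^bold>\<rightarrow> ((\<phi> \<^bold>\<cdot> \<psi>) \<^bold>\<rightarrow> \<chi>))"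
| A6: "luk_axiom (((\<phi> \<^bold>\<cdot> \<psi>) \<^bold>\<rightarrow> \<chi>) \<^bold>\<rightarrow> (\<phi> \<^bold>\<rightarrow> (\<psi> \<^bold>\<rightarrow> \<chi>)))"
| A7: "luk_axiom ((\<phi> \<^bold>\<cdot> (\<phi> \<^bold>\<rightarrow> \<psi>)) \<^bold>\<rightarrow> (\<phi> \<^bold>\<and> \<psi>))"
| A8: "luk_axiom ((\<phi> \<^bold>\<and> \<psi>) \<^bold>\<rightarrow> (\<phi> \<^bold>\<cdot> (\<phi> \<^bold>\<rightarrow> \<psi>)))"
| A9: "luk_axiom ((\<phi> \<^bold>\<and> \<psi>) \<^bold>\<rightarrow> (\<psi> \<^bold>\<and> \<phi>))"
| A10: "luk_axiom (\<phi> \<^bold>\<rightarrow> (\<phi> \<^bold>\<or> \<psi>))"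
| A11: "luk_axiom (\<psi> \<^bold>\<rightarrow> (\<phi> \<^bold>\<or> \<psi>))"
| A12: "luk_axiom (((\<phi> \<^bold>\<rightarrow> \<psi>) \<^bold>\<and> (\<chi> \<^bold>\<rightarrow> \<psi>)) \<^bold>\<rightarrow> ((\<phi> \<^bold>\<or> \<chi>) \<^bold>\<rightarrow> \<psi>))"
| A13: "luk_axiom (Zero \<^bold>\<rightarrow> \<phi>)"
| A14: "luk_axiom ((\<phi> \<^bold>\<rightarrow> \<psi>) \<^bold>\<or> (\<psi> \<^bold>\<rightarrow> \<phi>))"
| A15: "luk_axiom (\<^bold>\<not> (\<^bold>\<not> \<phi>) \<^bold>\<leftrightarrow> \<phi>)"
| Box_Imp: "luk_axiom (Box i (\<phi> \<^bold>\<rightarrow> \<psi>) \<^bold>\<rightarrow> (Box i \<phi> \<^bold>\<rightarrow> Box i \<psi>))"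
| Box_Fuse: "luk_axiom (Box i (\<phi> \<^bold>\<cdot> \<psi>) \<^bold>\<leftrightarrow> (Box i \<phi> \<^bold>\<cdot> Box i \<psi>))"
| Box_Conj: "luk_axiom (Box i (\<phi> \<^bold>\<and> \<psi>) \<^bold>\<leftrightarrow> (Box i \<phi> \<^bold>\<and> Box i \<psi>))"
| Box_One: "luk_axiom (Box i One \<^bold>\<leftrightarrow> One)"
| Box_Zero: "luk_axiom (Box i Zero \<^bold>\<leftrightarrow> Zero)"

text \<open>A set \<open>S\<close> of formulas is read as a set of axiom schemes, the variables being the
  metavariables, so that the instances of a scheme are its substitution instances.\<close>

inductive derives :: "'i set \<Rightarrow> 'i fm set \<Rightarrow> 'i fm set \<Rightarrow> 'i fm \<Rightarrow> bool"
  for I :: "'i set" and S :: "'i fm set" and \<Gamma> :: "'i fm set" where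
  premise: "\<phi> \<in> \<Gamma> \<Longrightarrow> derives I S \<Gamma> \<phi>"
| base_axiom: "luk_axiom \<phi> \<Longrightarrow> \<phi> \<in> formulas I \<Longrightarrow> derives I S \<Gamma> \<phi>"
| extra_axiom: "\<phi> \<in> S \<Longrightarrow> (\<And>n. \<sigma> n \<in> formulas I) \<Longrightarrow> derives I S \<Gamma> (subst \<sigma> \<phi>)"
| modus_ponens: "derives I S \<Gamma> \<phi> \<Longrightarrow> derives I S \<Gamma> (\<phi> \<^bold>\<rightarrow> \<psi>) \<Longrightarrow> derives I S \<Gamma> \<psi>"
| necessitation: "derives I S \<Gamma> \<phi> \<Longrightarrow> i \<in> I \<Longrightarrow> derives I S \<Gamma> (Box i \<phi>)"

type_synonym 'i conseq = "'i fm set \<Rightarrow> 'i fm \<Rightarrow> bool"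

definition axiomatic_extension :: "'i set \<Rightarrow> 'i conseq \<Rightarrow> bool" where
  "axiomatic_extension I L \<longleftrightarrow> (\<exists>S \<subseteq> formulas I. L = derives I S)"

record ('a, 'i) alg =
  carrier :: "'a set"
  meet :: "'a \<Rightarrow> 'a \<Rightarrow> 'a"
  join :: "'a \<Rightarrow> 'a \<Rightarrow> 'a"
  mult :: "'a \<Rightarrow> 'a \<Rightarrow> 'a"
  impl :: "'a \<Rightarrow> 'a \<Rightarrow> 'a"
  bottom :: 'a
  unit :: 'a
  box :: "'i \<Rightarrow> 'a \<Rightarrow> 'a"

definition leq :: "('a, 'i) alg \<Rightarrow> 'a \<Rightarrow> 'a \<Rightarrow> bool" where
  "leq A x y \<longleftrightarrow> meet A x y = x"

text \<open>MV-algebras in the signature of residuated lattices: bounded commutative integral residuated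
  lattices that are divisible, prelinear and involutive.\<close>

definition MV_algebra :: "('a, 'i) alg \<Rightarrow> bool" where
  "MV_algebra A \<longleftrightarrow>
     bottom A \<in> carrier A \<and> unit A \<in> carrier A \<and>
     (\<forall>x\<in>carrier A. \<forall>y\<in>carrier A. meet A x y \<in> carrier A \<and> join A x y \<in> carrier A \<and>
        mult A x y \<in> carrier A \<and> impl A x y \<in> carrier A) \<and>
     (\<forall>x\<in>carrier A. \<forall>y\<in>carrier A. meet A x y = meet A y x \<and> join A x y = join A y x) \<and>
     (\<forall>x\<in>carrier A. \<forall>y\<in>carrier A. \<forall>z\<in>carrier A.
        meet A (meet A x y) z = meet A x (meet A y z) \<and>
        join A (join A x y) z = join A x (join A y z)) \<and>
     (\<forall>x\<in>carrier A. \<forall>y\<in>carrier A. meet A x (join A x y) = x \<and> join A x (meet A x y) = x) \<and>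
     (\<forall>x\<in>carrier A. leq A (bottom A) x \<and> leq A x (unit A)) \<and>
     (\<forall>x\<in>carrier A. \<forall>y\<in>carrier A. \<forall>z\<in>carrier A.
        mult A (mult A x y) z = mult A x (mult A y z)) \<and>
     (\<forall>x\<in>carrier A. \<forall>y\<in>carrier A. mult A x y = mult A y x) \<and>
     (\<forall>x\<in>carrier A. mult A x (unit A) = x) \<and>
     (\<forall>x\<in>carrier A. \<forall>y\<in>carrier A. \<forall>z\<in>carrier A.
        leq A (mult A x y) z \<longleftrightarrow> leq A x (impl A y z)) \<and>
     (\<forall>x\<in>carrier A. \<forall>y\<in>carrier A. mult A x (impl A x y) = meet A x y) \<and>
     (\<forall>x\<in>carrier A. \<forall>y\<in>carrier A. join A (impl A x y) (impl A y x) = unit A) \<and>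
     (\<forall>x\<in>carrier A. impl A (impl A x (bottom A)) (bottom A) = x)"

definition MVI_algebra :: "'i set \<Rightarrow> ('a, 'i) alg \<Rightarrow> bool" where
  "MVI_algebra I A \<longleftrightarrow> MV_algebra A \<and>
     (\<forall>i\<in>I.
        (\<forall>x\<in>carrier A. box A i x \<in> carrier A) \<and>
        (\<forall>x\<in>carrier A. \<forall>y\<in>carrier A.
           box A i (meet A x y) = meet A (box A i x) (box A i y) \<and>
           box A i (mult A x y) = mult A (box A i x) (box A i y)) \<and>
        box A i (bottom A) = bottom A \<and> box A i (unit A) = unit A)"

primrec eval :: "('a, 'i) alg \<Rightarrow> (nat \<Rightarrow> 'a) \<Rightarrow> 'i fm \<Rightarrow> 'a" where
  "eval A v (Var n) = v n"
| "eval A v Zero = bottom A"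
| "eval A v One = unit A"
| "eval A v (\<phi> \<^bold>\<and> \<psi>) = meet A (eval A v \<phi>) (eval A v \<psi>)"
| "eval A v (\<phi> \<^bold>\<or> \<psi>) = join A (eval A v \<phi>) (eval A v \<psi>)"
| "eval A v (\<phi> \<^bold>\<cdot> \<psi>) = mult A (eval A v \<phi>) (eval A v \<psi>)"
| "eval A v (\<phi> \<^bold>\<rightarrow> \<psi>) = impl A (eval A v \<phi>) (eval A v \<psi>)"
| "eval A v (Box i \<phi>) = box A i (eval A v \<phi>)"

type_synonym 'i equation = "'i fm \<times> 'i fm"

definition holds :: "('a, 'i) alg \<Rightarrow> (nat \<Rightarrow> 'a) \<Rightarrow> 'i equation \<Rightarrow> bool" where
  "holds A v e \<longleftrightarrow> eval A v (fst e) = eval A v (snd e)"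

definition valid :: "('a, 'i) alg \<Rightarrow> 'i equation \<Rightarrow> bool" where
  "valid A e \<longleftrightarrow> (\<forall>v \<in> UNIV \<rightarrow> carrier A. holds A v e)"

text \<open>Varieties are equational classes. HOL cannot quantify over algebras on all types, so a class
  of algebras is represented by its members whose carrier is a subset of \<^typ>\<open>'i fm\<close>. Neither
  validity of equations nor equational consequence is affected: a countermodel contains one
  generated by the values of the variables, which is an image of the formula algebra and hence
  isomorphic to an algebra on a set of formulas.\<close>

type_synonym 'i alg_class = "('i fm, 'i) alg set"

definition subvariety_MVI :: "'i set \<Rightarrow> 'i alg_class \<Rightarrow> bool" where
  "subvariety_MVI I V \<longleftrightarrow>
     (\<exists>E \<subseteq> formulas I \<times> formulas I. V = {A. MVI_algebra I A \<and> (\<forall>e\<in>E. valid A e)})"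

definition eq_conseq :: "'i alg_class \<Rightarrow> 'i equation set \<Rightarrow> 'i equation \<Rightarrow> bool" where
  "eq_conseq V \<Theta> e \<longleftrightarrow>
     (\<forall>A\<in>V. \<forall>v \<in> UNIV \<rightarrow> carrier A. (\<forall>d\<in>\<Theta>. holds A v d) \<longrightarrow> holds A v e)"

text \<open>Transformers in the sense of Blok and Pigozzi: \<open>\<tau>\<close> is a set of equations in the variable \<open>0\<close>,
  \<open>\<rho>\<close> a set of formulas in the variables \<open>0\<close> and \<open>1\<close>.\<close>

definition fm_to_eqs :: "'i equation set \<Rightarrow> 'i fm \<Rightarrow> 'i equation set" where
  "fm_to_eqs \<tau> \<phi> = (\<lambda>(s, t). (subst (\<lambda>_. \<phi>) s, subst (\<lambda>_. \<phi>) t)) ` \<tau>"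

definition eq_to_fms :: "'i fm set \<Rightarrow> 'i equation \<Rightarrow> 'i fm set" where
  "eq_to_fms \<rho> e = subst (\<lambda>n. if n = 0 then fst e else snd e) ` \<rho>"

text \<open>\<open>V\<close> is the equivalent algebraic semantics of \<open>L\<close> (Blok and Pigozzi).\<close>

definition algebraized_by :: "'i set \<Rightarrow> 'i conseq \<Rightarrow> 'i alg_class \<Rightarrow> bool" where
  "algebraized_by I L V \<longleftrightarrow>
     (\<exists>\<tau> \<rho>.
        finite \<tau> \<and> \<tau> \<subseteq> formulas I \<times> formulas I \<and> (\<forall>(s, t)\<in>\<tau>. vars s \<union> vars t \<subseteq> {0}) \<and>
        finite \<rho> \<and> \<rho> \<subseteq> formulas I \<and> (\<forall>\<phi>\<in>\<rho>. vars \<phi> \<subseteq> {0, 1}) \<and>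
        (\<forall>\<Gamma> \<subseteq> formulas I. \<forall>\<phi> \<in> formulas I.
           L \<Gamma> \<phi> \<longleftrightarrow> (\<forall>e \<in> fm_to_eqs \<tau> \<phi>. eq_conseq V (\<Union>\<gamma>\<in>\<Gamma>. fm_to_eqs \<tau> \<gamma>) e)) \<and>
        (\<forall>e \<in> formulas I \<times> formulas I.
           (\<forall>\<phi> \<in> eq_to_fms \<rho> e. \<forall>d \<in> fm_to_eqs \<tau> \<phi>. eq_conseq V {e} d) \<and>
           eq_conseq V (\<Union>\<phi> \<in> eq_to_fms \<rho> e. fm_to_eqs \<tau> \<phi>) e))"

text \<open>The empty word is admitted as a block, with \<open>M(\<phi>) = \<phi>\<close>. Were only nonempty words admitted,
  \<open>\<phi>\<close> would not be recovered from the premise \<open>\<phi>\<close>: for \<open>I = {}\<close> there would be no blocks at all,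
  and if \<open>I\<close> is nonempty, no product of formulas \<open>M(p)\<close> with \<open>M\<close> nonempty implies \<open>p\<close> in
  \<open>MV(I)\<close>, as the algebra \<open>{0,1} \<times> {0,1}\<close> with every box acting as \<open>(x, y) \<mapsto> (x, x)\<close> shows at
  \<open>p = (1, 0)\<close>.\<close>

definition blocks :: "'i set \<Rightarrow> 'i list set" where
  "blocks I = lists I"

definition apply_block :: "'i list \<Rightarrow> 'i fm \<Rightarrow> 'i fm" where
  "apply_block M \<phi> = foldr Box M \<phi>"

fun fm_prod :: "'i fm list \<Rightarrow> 'i fm" where
  "fm_prod [] = One"
| "fm_prod [\<phi>] = \<phi>"
| "fm_prod (\<phi> # \<psi> # \<phi>s) = \<phi> \<^bold>\<cdot> fm_prod (\<psi> # \<phi>s)"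

end

theory Submission
  imports Defs
begin

text \<open>The nontrivial direction is an induction on derivations. Since \<open>\<phi> \<rightarrow> (\<psi> \<rightarrow> \<chi>)\<close> and
  \<open>\<phi> \<cdot> \<psi> \<rightarrow> \<chi>\<close> are interderivable, products of block instances of \<open>\<Delta>\<close> can be concatenated, which
  takes care of modus ponens; since each box distributes over implication, a box can be pushed into
  every factor, which takes care of necessitation. The only use of the algebraic semantics is the
  derivability of \<open>1\<close>: the theorem \<open>p \<rightarrow> p\<close> takes the value \<open>1\<close> in every algebra of \<open>V\<close>, so \<open>1\<close>
  satisfies the defining equations of the logic.\<close>

section \<open>Closure of formulas and of derivability\<close>

lemma formulas_simps [simp]:
  "Var n \<in> formulas I" "Zero \<in> formulas I" "One \<in> formulas I"
  "\<phi> \<^bold>\<and> \<psi> \<in> formulas I \<longleftrightarrow> \<phi> \<in> formulas I \<and> \<psi> \<in> formulas I"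
  "\<phi> \<^bold>\<or> \<psi> \<in> formulas I \<longleftrightarrow> \<phi> \<in> formulas I \<and> \<psi> \<in> formulas I"
  "\<phi> \<^bold>\<cdot> \<psi> \<in> formulas I \<longleftrightarrow> \<phi> \<in> formulas I \<and> \<psi> \<in> formulas I"
  "\<phi> \<^bold>\<rightarrow> \<psi> \<in> formulas I \<longleftrightarrow> \<phi> \<in> formulas I \<and> \<psi> \<in> formulas I"
  "Box i \<phi> \<in> formulas I \<longleftrightarrow> i \<in> I \<and> \<phi> \<in> formulas I"
  by (auto simp: formulas_def)

lemma subst_in_formulas:
  "\<phi> \<in> formulas I \<Longrightarrow> (\<And>n. \<sigma> n \<in> formulas I) \<Longrightarrow> subst \<sigma> \<phi> \<in> formulas I"
  by (induction \<phi>) auto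

lemma fm_prod_in_formulas [simp]: "fm_prod ps \<in> formulas I \<longleftrightarrow> set ps \<subseteq> formulas I"
  by (induction ps rule: fm_prod.induct) auto

lemma derives_mono: "derives I S \<Gamma> \<phi> \<Longrightarrow> \<Gamma> \<subseteq> \<Gamma>' \<Longrightarrow> derives I S \<Gamma>' \<phi>"
proof (induction rule: derives.induct)
  case (modus_ponens \<phi> \<psi>)
  then show ?case using derives.modus_ponens by blast
qed (auto intro: derives.premise derives.base_axiom derives.extra_axiom derives.necessitation)

lemma derives_in_formulas:
  "derives I S \<Gamma> \<phi> \<Longrightarrow> S \<subseteq> formulas I \<Longrightarrow> \<Gamma> \<subseteq> formulas I \<Longrightarrow> \<phi> \<in> formulas I"
  by (induction rule: derives.induct) (auto intro: subst_in_formulas)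

lemma derives_apply_block:
  "derives I S \<Gamma> \<phi> \<Longrightarrow> M \<in> blocks I \<Longrightarrow> derives I S \<Gamma> (apply_block M \<phi>)"
  unfolding blocks_def apply_block_def by (induction M) (auto intro: derives.necessitation)

section \<open>Derivability of \<open>One\<close> from the algebraic semantics\<close>

lemma eval_subst: "eval A v (subst \<sigma> \<phi>) = eval A (\<lambda>n. eval A v (\<sigma> n)) \<phi>"
  by (induction \<phi>) auto

text \<open>Residuation turns \<open>1 * x = x \<le> x\<close> into \<open>1 \<le> x -> x\<close>,
  and \<open>1\<close> is the top element.\<close>

lemma MV_algebra_impl_self:
  assumes "MV_algebra A" "x \<in> carrier A"
  shows "impl A x x = unit A"
proof -
  have unit: "unit A \<in> carrier A"
    and closed: "\<forall>x\<in>carrier A. \<forall>y\<in>carrier A. meet A x y \<in> carrier A \<and> join A x y \<in> carrier A \<and>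
      mult A x y \<in> carrier A \<and> impl A x y \<in> carrier A"
    and commute: "\<forall>x\<in>carrier A. \<forall>y\<in>carrier A. meet A x y = meet A y x \<and> join A x y = join A y x"
    and absorb: "\<forall>x\<in>carrier A. \<forall>y\<in>carrier A. meet A x (join A x y) = x \<and> join A x (meet A x y) = x"
    and bounds: "\<forall>x\<in>carrier A. leq A (bottom A) x \<and> leq A x (unit A)"
    and mult_commute: "\<forall>x\<in>carrier A. \<forall>y\<in>carrier A. mult A x y = mult A y x"
    and mult_unit: "\<forall>x\<in>carrier A. mult A x (unit A) = x"
    and residuation: "\<forall>x\<in>carrier A. \<forall>y\<in>carrier A. \<forall>z\<in>carrier A.
      leq A (mult A x y) z \<longleftrightarrow> leq A x (impl A y z)"
    using assms(1) by (simp_all only: MV_algebra_def) (elim conjE, assumption)+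
  have xx: "impl A x x \<in> carrier A" "meet A x x \<in> carrier A"
    using closed assms(2) by auto
  have "leq A x x"
    unfolding leq_def using absorb assms(2) xx(2) by metis
  moreover have "mult A (unit A) x = x"
    using mult_commute mult_unit unit assms(2) by metis
  ultimately have "leq A (unit A) (impl A x x)"
    using residuation unit assms(2) by metis
  moreover have "leq A (impl A x x) (unit A)"
    using bounds xx(1) by blast
  ultimately show ?thesis
    unfolding leq_def using commute unit xx(1) by metis
qed

lemma algebraized_derives_One:
  assumes "algebraized_by I (derives I S) V" and "subvariety_MVI I V"
  shows "derives I S {} One"
proof -
  obtain \<tau> where "\<forall>\<Gamma> \<subseteq> formulas I. \<forall>\<phi> \<in> formulas I. derives I S \<Gamma> \<phi> \<longleftrightarrow>
      (\<forall>e \<in> fm_to_eqs \<tau> \<phi>. eq_conseq V (\<Union>\<gamma>\<in>\<Gamma>. fm_to_eqs \<tau> \<gamma>) e)"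
    using assms(1) unfolding algebraized_by_def by (elim exE conjE)
  \<comment> \<open>Without premises the translated premise set is empty, so theorems are exactly
    the formulas whose \<open>\<tau>\<close>-equations hold throughout \<open>V\<close>.\<close>
  from this[rule_format, of "{}"]
  have iff: "derives I S {} \<phi> \<longleftrightarrow> (\<forall>e \<in> fm_to_eqs \<tau> \<phi>. eq_conseq V {} e)"
    if "\<phi> \<in> formulas I" for \<phi>
    using that by simp
  let ?T = "Var 0 \<^bold>\<rightarrow> Var 0 :: 'a fm"
  have T: "derives I S {} ?T"
    by (rule derives.base_axiom) (auto intro: luk_axiom.intros)
  have "eq_conseq V {} (subst (\<lambda>_. One) s, subst (\<lambda>_. One) t)" if "(s, t) \<in> \<tau>" for s t
    unfolding eq_conseq_def
  proof (intro ballI impI)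
    fix A and v :: "nat \<Rightarrow> 'a fm"
    assume A: "A \<in> V" and v: "v \<in> UNIV \<rightarrow> carrier A"
    have "MV_algebra A"
      using A assms(2) by (auto simp: subvariety_MVI_def MVI_algebra_def)
    then have unit: "impl A (v 0) (v 0) = unit A"
      using v by (intro MV_algebra_impl_self) auto
    have "(subst (\<lambda>_. ?T) s, subst (\<lambda>_. ?T) t) \<in> fm_to_eqs \<tau> ?T"
      using that by (force simp: fm_to_eqs_def)
    then have "holds A v (subst (\<lambda>_. ?T) s, subst (\<lambda>_. ?T) t)"
      using iff[of ?T] T A v by (auto simp: eq_conseq_def)
    \<comment> \<open>The value of a substitution instance depends only on the value of the
      substituted formula, and \<open>?T\<close> and \<open>One\<close> both take the value
      \<open>unit A\<close>.\<close>
    then show "holds A v (subst (\<lambda>_. One) s, subst (\<lambda>_. One) t)"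
      by (simp add: holds_def eval_subst unit)
  qed
  then show ?thesis
    by (subst iff) (auto simp: fm_to_eqs_def)
qed

section \<open>Derived rules over a fixed set of premises\<close>

text \<open>What is retained of algebraization is the single theorem \<open>One\<close>; from here
  on the argument is syntactic.\<close>

locale unital_extension =
  fixes I :: "'i set" and S :: "'i fm set"
  assumes schemes: "S \<subseteq> formulas I"
    and One: "derives I S {} One"
begin

abbreviation proves :: "'i fm set \<Rightarrow> 'i fm \<Rightarrow> bool" (infix \<open>\<turnstile>\<close> 50) where
  "\<Gamma> \<turnstile> \<phi> \<equiv> derives I S \<Gamma> \<phi>"

context
  fixes \<Gamma> :: "'i fm set"
  assumes context_formulas: "\<Gamma> \<subseteq> formulas I"
begin

text \<open>Base axioms are available only inside \<open>formulas I\<close>; this recovers that side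
  condition from the premises of each derived rule.\<close>

lemma proves_in_formulas: "\<Gamma> \<turnstile> \<phi> \<Longrightarrow> \<phi> \<in> formulas I"
  using derives_in_formulas schemes context_formulas by blast

lemma proves_One: "\<Gamma> \<turnstile> One"
  using One by (rule derives_mono) simp

lemma proves_trans:
  assumes "\<Gamma> \<turnstile> \<phi> \<^bold>\<rightarrow> \<psi>" "\<Gamma> \<turnstile> \<psi> \<^bold>\<rightarrow> \<chi>"
  shows "\<Gamma> \<turnstile> \<phi> \<^bold>\<rightarrow> \<chi>"
proof -
  have "\<Gamma> \<turnstile> (\<phi> \<^bold>\<rightarrow> \<psi>) \<^bold>\<rightarrow> ((\<psi> \<^bold>\<rightarrow> \<chi>) \<^bold>\<rightarrow> (\<phi> \<^bold>\<rightarrow> \<chi>))"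
    using assms[THEN proves_in_formulas] by (intro derives.base_axiom luk_axiom.A2) auto
  then show ?thesis
    using assms derives.modus_ponens by blast
qed

lemma proves_fuse_iff: "\<Gamma> \<turnstile> (\<phi> \<^bold>\<cdot> \<psi>) \<^bold>\<rightarrow> \<chi> \<longleftrightarrow> \<Gamma> \<turnstile> \<phi> \<^bold>\<rightarrow> (\<psi> \<^bold>\<rightarrow> \<chi>)"
proof
  assume *: "\<Gamma> \<turnstile> (\<phi> \<^bold>\<cdot> \<psi>) \<^bold>\<rightarrow> \<chi>"
  have "\<Gamma> \<turnstile> ((\<phi> \<^bold>\<cdot> \<psi>) \<^bold>\<rightarrow> \<chi>) \<^bold>\<rightarrow> (\<phi> \<^bold>\<rightarrow> (\<psi> \<^bold>\<rightarrow> \<chi>))"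
    using *[THEN proves_in_formulas] by (intro derives.base_axiom luk_axiom.A6) auto
  with * show "\<Gamma> \<turnstile> \<phi> \<^bold>\<rightarrow> (\<psi> \<^bold>\<rightarrow> \<chi>)"
    by (rule derives.modus_ponens)
next
  assume *: "\<Gamma> \<turnstile> \<phi> \<^bold>\<rightarrow> (\<psi> \<^bold>\<rightarrow> \<chi>)"
  have "\<Gamma> \<turnstile> (\<phi> \<^bold>\<rightarrow> (\<psi> \<^bold>\<rightarrow> \<chi>)) \<^bold>\<rightarrow> ((\<phi> \<^bold>\<cdot> \<psi>) \<^bold>\<rightarrow> \<chi>)"
    using *[THEN proves_in_formulas] by (intro derives.base_axiom luk_axiom.A5) auto
  with * show "\<Gamma> \<turnstile> (\<phi> \<^bold>\<cdot> \<psi>) \<^bold>\<rightarrow> \<chi>"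
    by (rule derives.modus_ponens)
qed

lemma proves_fuse_commute:
  "\<phi> \<in> formulas I \<Longrightarrow> \<psi> \<in> formulas I \<Longrightarrow> \<Gamma> \<turnstile> (\<phi> \<^bold>\<cdot> \<psi>) \<^bold>\<rightarrow> (\<psi> \<^bold>\<cdot> \<phi>)"
  by (intro derives.base_axiom luk_axiom.A3) auto

text \<open>Axiom A4 discards the left factor; after commuting the product, residuation yields
  \<open>\<psi> -> (\<phi> -> \<psi>)\<close>.\<close>

lemma proves_weaken:
  assumes "\<Gamma> \<turnstile> \<psi>" "\<phi> \<in> formulas I"
  shows "\<Gamma> \<turnstile> \<phi> \<^bold>\<rightarrow> \<psi>"
proof -
  have \<psi>: "\<psi> \<in> formulas I"
    using assms(1) by (rule proves_in_formulas)
  have "\<Gamma> \<turnstile> (\<phi> \<^bold>\<cdot> \<psi>) \<^bold>\<rightarrow> \<psi>"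
    using assms(2) \<psi> by (intro derives.base_axiom luk_axiom.A4) auto
  then have "\<Gamma> \<turnstile> (\<psi> \<^bold>\<cdot> \<phi>) \<^bold>\<rightarrow> \<psi>"
    using proves_trans proves_fuse_commute assms(2) \<psi> by blast
  then show ?thesis
    using assms(1) proves_fuse_iff derives.modus_ponens by blast
qed

lemma proves_exchange:
  assumes "\<Gamma> \<turnstile> \<phi> \<^bold>\<rightarrow> (\<psi> \<^bold>\<rightarrow> \<chi>)"
  shows "\<Gamma> \<turnstile> \<psi> \<^bold>\<rightarrow> (\<phi> \<^bold>\<rightarrow> \<chi>)"
proof -
  have "\<Gamma> \<turnstile> (\<psi> \<^bold>\<cdot> \<phi>) \<^bold>\<rightarrow> (\<phi> \<^bold>\<cdot> \<psi>)"
    using assms[THEN proves_in_formulas] by (intro proves_fuse_commute) auto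
  then show ?thesis
    using assms proves_trans proves_fuse_iff by blast
qed

text \<open>Exchange as a provable implication, so that it can be applied underneath an antecedent.
  It composes A5, commutativity of the product made into a change of antecedent by A2, and
  A6.\<close>

lemma proves_exchange_imp:
  assumes "\<phi> \<in> formulas I" "\<psi> \<in> formulas I" "\<chi> \<in> formulas I"
  shows "\<Gamma> \<turnstile> (\<phi> \<^bold>\<rightarrow> (\<psi> \<^bold>\<rightarrow> \<chi>)) \<^bold>\<rightarrow> (\<psi> \<^bold>\<rightarrow> (\<phi> \<^bold>\<rightarrow> \<chi>))"
proof -
  have "\<Gamma> \<turnstile> (\<phi> \<^bold>\<rightarrow> (\<psi> \<^bold>\<rightarrow> \<chi>)) \<^bold>\<rightarrow> ((\<phi> \<^bold>\<cdot> \<psi>) \<^bold>\<rightarrow> \<chi>)"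
    using assms by (intro derives.base_axiom luk_axiom.A5) auto
  moreover have "\<Gamma> \<turnstile> ((\<phi> \<^bold>\<cdot> \<psi>) \<^bold>\<rightarrow> \<chi>) \<^bold>\<rightarrow> ((\<psi> \<^bold>\<cdot> \<phi>) \<^bold>\<rightarrow> \<chi>)"
  proof (rule derives.modus_ponens)
    show "\<Gamma> \<turnstile> (\<psi> \<^bold>\<cdot> \<phi>) \<^bold>\<rightarrow> (\<phi> \<^bold>\<cdot> \<psi>)"
      using assms by (intro proves_fuse_commute)
    show "\<Gamma> \<turnstile> ((\<psi> \<^bold>\<cdot> \<phi>) \<^bold>\<rightarrow> (\<phi> \<^bold>\<cdot> \<psi>)) \<^bold>\<rightarrow>
        (((\<phi> \<^bold>\<cdot> \<psi>) \<^bold>\<rightarrow> \<chi>) \<^bold>\<rightarrow> ((\<psi> \<^bold>\<cdot> \<phi>) \<^bold>\<rightarrow> \<chi>))"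
      using assms by (intro derives.base_axiom luk_axiom.A2) auto
  qed
  moreover have "\<Gamma> \<turnstile> ((\<psi> \<^bold>\<cdot> \<phi>) \<^bold>\<rightarrow> \<chi>) \<^bold>\<rightarrow> (\<psi> \<^bold>\<rightarrow> (\<phi> \<^bold>\<rightarrow> \<chi>))"
    using assms by (intro derives.base_axiom luk_axiom.A6) auto
  ultimately show ?thesis
    using proves_trans by blast
qed

text \<open>This treats the empty product: left to right is modus ponens with the theorem
  \<open>One\<close>, right to left is weakening.\<close>

lemma proves_One_imp_iff: "\<Gamma> \<turnstile> One \<^bold>\<rightarrow> \<phi> \<longleftrightarrow> \<Gamma> \<turnstile> \<phi>"
  using derives.modus_ponens[OF proves_One] proves_weaken[of \<phi> One] by auto

text \<open>A nonempty product carries no trailing \<open>One\<close>, so singletons and longer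
  lists have different shapes. This equivalence absorbs the distinction and lets later inductions
  move one factor at a time into the consequent.\<close>

lemma proves_fm_prod_Cons_iff:
  "\<Gamma> \<turnstile> fm_prod (\<phi> # ps) \<^bold>\<rightarrow> \<psi> \<longleftrightarrow> \<Gamma> \<turnstile> fm_prod ps \<^bold>\<rightarrow> (\<phi> \<^bold>\<rightarrow> \<psi>)"
proof (cases ps)
  case Nil
  then show ?thesis by (simp add: proves_One_imp_iff)
next
  case (Cons q qs)
  then show ?thesis by (auto simp: proves_fuse_iff intro: proves_exchange)
qed

text \<open>The consequent is left arbitrary in the induction: the first factor \<open>p\<close>
  moves to the right, is exchanged past \<open>fm_prod qs\<close>, and the induction hypothesis is
  used for \<open>p -> \<psi>\<close>.\<close>

lemma proves_fm_prod_append: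
  assumes "\<Gamma> \<turnstile> fm_prod ps \<^bold>\<rightarrow> (fm_prod qs \<^bold>\<rightarrow> \<psi>)"
  shows "\<Gamma> \<turnstile> fm_prod (ps @ qs) \<^bold>\<rightarrow> \<psi>"
  using assms
proof (induction ps arbitrary: \<psi>)
  case Nil
  then show ?case by (simp add: proves_One_imp_iff)
next
  case (Cons p ps)
  then have "\<Gamma> \<turnstile> fm_prod ps \<^bold>\<rightarrow> (p \<^bold>\<rightarrow> (fm_prod qs \<^bold>\<rightarrow> \<psi>))"
    by (simp only: proves_fm_prod_Cons_iff)
  \<comment> \<open>The exchange takes place below the antecedent \<open>fm_prod ps\<close>, hence
    the implication form and a composition.\<close>
  moreover from this have "\<Gamma> \<turnstile> (p \<^bold>\<rightarrow> (fm_prod qs \<^bold>\<rightarrow> \<psi>)) \<^bold>\<rightarrow> (fm_prod qs \<^bold>\<rightarrow> (p \<^bold>\<rightarrow> \<psi>))"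
    by (intro proves_exchange_imp) (auto dest!: proves_in_formulas)
  ultimately have "\<Gamma> \<turnstile> fm_prod ps \<^bold>\<rightarrow> (fm_prod qs \<^bold>\<rightarrow> (p \<^bold>\<rightarrow> \<psi>))"
    by (rule proves_trans)
  then show ?case
    using Cons.IH by (simp only: append_Cons proves_fm_prod_Cons_iff)
qed

text \<open>With the consequent arbitrary, the induction hypothesis boxes
  \<open>p -> \<psi>\<close>, and the distribution of the box over implication splits off the factor
  \<open>Box i p\<close>. The empty product reduces to necessitation.\<close>

lemma proves_fm_prod_map_Box:
  assumes "\<Gamma> \<turnstile> fm_prod ps \<^bold>\<rightarrow> \<psi>" "i \<in> I"
  shows "\<Gamma> \<turnstile> fm_prod (map (Box i) ps) \<^bold>\<rightarrow> Box i \<psi>"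
  using assms(1)
proof (induction ps arbitrary: \<psi>)
  case Nil
  then show ?case
    using assms(2) by (simp add: proves_One_imp_iff derives.necessitation)
next
  case (Cons p ps)
  then have *: "\<Gamma> \<turnstile> fm_prod ps \<^bold>\<rightarrow> (p \<^bold>\<rightarrow> \<psi>)"
    by (simp only: proves_fm_prod_Cons_iff)
  have "\<Gamma> \<turnstile> Box i (p \<^bold>\<rightarrow> \<psi>) \<^bold>\<rightarrow> (Box i p \<^bold>\<rightarrow> Box i \<psi>)"
    using proves_in_formulas[OF *] assms(2)
    by (intro derives.base_axiom luk_axiom.Box_Imp) auto
  then have "\<Gamma> \<turnstile> fm_prod (map (Box i) ps) \<^bold>\<rightarrow> (Box i p \<^bold>\<rightarrow> Box i \<psi>)"
    using Cons.IH[OF *] proves_trans by blast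
  then show ?case
    by (simp only: list.map proves_fm_prod_Cons_iff)
qed

lemma proves_from_fm_prod:
  assumes "\<Gamma> \<turnstile> fm_prod ps \<^bold>\<rightarrow> \<psi>" "\<And>p. p \<in> set ps \<Longrightarrow> \<Gamma> \<turnstile> p"
  shows "\<Gamma> \<turnstile> \<psi>"
  using assms
proof (induction ps arbitrary: \<psi>)
  case Nil
  then show ?case by (simp add: proves_One_imp_iff)
next
  case (Cons p ps)
  then have "\<Gamma> \<turnstile> p \<^bold>\<rightarrow> \<psi>"
    by (auto simp only: proves_fm_prod_Cons_iff list.set intro: insertI2)
  then show ?case
    using Cons.prems(2) by (auto intro: derives.modus_ponens)
qed

end

section \<open>The local deduction theorem for lists of factors\<close>

lemma deduction:
  assumes "\<Gamma> \<union> \<Delta> \<turnstile> \<psi>" and "\<Gamma> \<subseteq> formulas I" and "\<Delta> \<subseteq> formulas I"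
  shows "\<exists>ps. set ps \<subseteq> {apply_block M \<chi> |M \<chi>. M \<in> blocks I \<and> \<chi> \<in> \<Delta>} \<and> \<Gamma> \<turnstile> fm_prod ps \<^bold>\<rightarrow> \<psi>"
    (is "\<exists>ps. set ps \<subseteq> ?B \<and> _")
  using assms(1)
proof (induction rule: derives.induct)
  \<comment> \<open>Members of \<open>\<Gamma>\<close> and axioms are derivable from
    \<open>\<Gamma>\<close> alone, so the empty list with product \<open>One\<close> serves as
    witness.\<close>
  have no_factors: "\<exists>ps. set ps \<subseteq> ?B \<and> \<Gamma> \<turnstile> fm_prod ps \<^bold>\<rightarrow> \<phi>" if "\<Gamma> \<turnstile> \<phi>" for \<phi>
    using that by (intro exI[of _ "[]"]) (simp add: proves_One_imp_iff[OF assms(2)])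
  {
    case (premise \<phi>)
    show ?case
    proof (cases "\<phi> \<in> \<Gamma>")
      case True
      then show ?thesis by (intro no_factors derives.premise)
    next
      case False
      then have "\<phi> \<in> \<Delta>"
        using premise by blast
      moreover from this have "\<Gamma> \<turnstile> \<phi> \<^bold>\<rightarrow> \<phi>"
        using assms(3) by (intro derives.base_axiom luk_axiom.A1) auto
      \<comment> \<open>The empty block makes a member of \<open>\<Delta>\<close> itself an
        admissible factor.\<close>
      moreover have "\<phi> = apply_block [] \<phi>" "[] \<in> blocks I"
        by (simp_all add: apply_block_def blocks_def)
      ultimately show ?thesis
        by (intro exI[of _ "[\<phi>]"]) auto
    qed
  next
    case (base_axiom \<phi>)
    then show ?case by (intro no_factors derives.base_axiom)
  next
    case (extra_axiom \<phi> \<sigma>)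
    then show ?case by (intro no_factors derives.extra_axiom)
  next
    case (modus_ponens \<phi> \<psi>)
    then obtain ps qs where ps: "set ps \<subseteq> ?B" "\<Gamma> \<turnstile> fm_prod ps \<^bold>\<rightarrow> \<phi>"
      and qs: "set qs \<subseteq> ?B" "\<Gamma> \<turnstile> fm_prod qs \<^bold>\<rightarrow> (\<phi> \<^bold>\<rightarrow> \<psi>)"
      by blast
    \<comment> \<open>Exchange in the second premise gives
      \<open>\<phi> -> (fm_prod qs -> \<psi>)\<close>, which composes with
      \<open>fm_prod ps -> \<phi>\<close>.\<close>
    have "\<Gamma> \<turnstile> fm_prod (ps @ qs) \<^bold>\<rightarrow> \<psi>"
      by (rule proves_fm_prod_append[OF assms(2)], rule proves_trans[OF assms(2) ps(2)],
          rule proves_exchange[OF assms(2) qs(2)])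
    then show ?case
      using ps(1) qs(1) by (intro exI[of _ "ps @ qs"]) auto
  next
    case (necessitation \<phi> i)
    then obtain ps where ps: "set ps \<subseteq> ?B" "\<Gamma> \<turnstile> fm_prod ps \<^bold>\<rightarrow> \<phi>"
      by blast
    \<comment> \<open>Block instances are closed under boxes: the new letter goes to the front of
      the word, which is the outermost position.\<close>
    have "Box i p \<in> ?B" if p: "p \<in> ?B" for p
    proof -
      obtain M \<chi> where "p = apply_block M \<chi>" "M \<in> blocks I" "\<chi> \<in> \<Delta>"
        using p by blast
      then have "Box i p = apply_block (i # M) \<chi>" "i # M \<in> blocks I" "\<chi> \<in> \<Delta>"
        using necessitation.hyps(2) by (auto simp: apply_block_def blocks_def)
      then show ?thesis by blast
    qed
    then have "set (map (Box i) ps) \<subseteq> ?B"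
      unfolding set_map image_subset_iff using ps(1)[THEN subsetD] by (intro ballI) simp
    then show ?case
      using proves_fm_prod_map_Box[OF assms(2) ps(2) necessitation.hyps(2)]
      by (intro exI conjI)
  }
qed

lemma deduction_iff:
  assumes "\<Gamma> \<subseteq> formulas I" and "\<Delta> \<subseteq> formulas I"
  shows "\<Gamma> \<union> \<Delta> \<turnstile> \<psi> \<longleftrightarrow>
    (\<exists>ps. set ps \<subseteq> {apply_block M \<chi> |M \<chi>. M \<in> blocks I \<and> \<chi> \<in> \<Delta>} \<and> \<Gamma> \<turnstile> fm_prod ps \<^bold>\<rightarrow> \<psi>)"
proof
  assume "\<exists>ps. set ps \<subseteq> {apply_block M \<chi> |M \<chi>. M \<in> blocks I \<and> \<chi> \<in> \<Delta>} \<and> \<Gamma> \<turnstile> fm_prod ps \<^bold>\<rightarrow> \<psi>"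
  then obtain ps where ps: "set ps \<subseteq> {apply_block M \<chi> |M \<chi>. M \<in> blocks I \<and> \<chi> \<in> \<Delta>}"
    and "\<Gamma> \<turnstile> fm_prod ps \<^bold>\<rightarrow> \<psi>"
    by blast
  then have "\<Gamma> \<union> \<Delta> \<turnstile> fm_prod ps \<^bold>\<rightarrow> \<psi>"
    by (blast intro: derives_mono)
  \<comment> \<open>Necessitation applies to premises as well, so every block instance of a member
    of \<open>\<Delta>\<close> is derivable.\<close>
  moreover have "\<Gamma> \<union> \<Delta> \<turnstile> p" if "p \<in> set ps" for p
    using that ps by (fastforce intro: derives_apply_block derives.premise)
  ultimately show "\<Gamma> \<union> \<Delta> \<turnstile> \<psi>"
    using assms proves_from_fm_prod[of "\<Gamma> \<union> \<Delta>" ps] by simp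
qed (rule deduction[OF _ assms])

end

section \<open>From lists of factors to families indexed by \<open>1, ..., n\<close>\<close>

lemma list_of_images_iff:
  "set ps \<subseteq> {f x y |x y. x \<in> X \<and> y \<in> Y} \<longleftrightarrow>
    (\<exists>n a b. (\<forall>j\<in>{1..n}. a j \<in> X \<and> b j \<in> Y) \<and> ps = map (\<lambda>j. f (a j) (b j)) [1..<Suc n])"
proof
  assume *: "set ps \<subseteq> {f x y |x y. x \<in> X \<and> y \<in> Y}"
  have "\<exists>x y. x \<in> X \<and> y \<in> Y \<and> ps ! (j - 1) = f x y" if "j \<in> {1..length ps}" for j
  proof -
    have "ps ! (j - 1) \<in> set ps"
      using that by (intro nth_mem) auto
    then show ?thesis
      using * by blast
  qed
  then obtain a b where ab: "a j \<in> X \<and> b j \<in> Y \<and> ps ! (j - 1) = f (a j) (b j)"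
    if "j \<in> {1..length ps}" for j
    by metis
  \<comment> \<open>List positions start at 0 and the families at 1, hence the shift by
    \<open>Suc\<close>.\<close>
  have "ps ! i = f (a (Suc i)) (b (Suc i))" if "i < length ps" for i
    using ab[of "Suc i"] that by simp
  then have "ps = map (\<lambda>j. f (a j) (b j)) [1..<Suc (length ps)]"
    by (intro nth_equalityI) (simp_all del: upt_Suc)
  then show "\<exists>n a b. (\<forall>j\<in>{1..n}. a j \<in> X \<and> b j \<in> Y) \<and> ps = map (\<lambda>j. f (a j) (b j)) [1..<Suc n]"
    using ab by blast
next
  assume "\<exists>n a b. (\<forall>j\<in>{1..n}. a j \<in> X \<and> b j \<in> Y) \<and> ps = map (\<lambda>j. f (a j) (b j)) [1..<Suc n]"
  then obtain n a b where ab: "\<forall>j\<in>{1..n}. a j \<in> X \<and> b j \<in> Y"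
    and "ps = map (\<lambda>j. f (a j) (b j)) [1..<Suc n]"
    by blast
  then have "set ps = (\<lambda>j. f (a j) (b j)) ` {1..n}"
    by (simp only: set_map set_upt atLeastLessThanSuc_atLeastAtMost)
  with ab show "set ps \<subseteq> {f x y |x y. x \<in> X \<and> y \<in> Y}"
    by blast
qed

theorem theorem3:
  fixes I :: "'i set" and L :: "'i conseq" and V :: "'i alg_class"
    and \<Gamma> \<Delta> :: "'i fm set" and \<psi> :: "'i fm"
  assumes "axiomatic_extension I L"
    and "subvariety_MVI I V"
    and "algebraized_by I L V"
    and "\<Gamma> \<union> \<Delta> \<union> {\<psi>} \<subseteq> formulas I"
  shows "L (\<Gamma> \<union> \<Delta>) \<psi> \<longleftrightarrow>
    (\<exists>n::nat. \<exists>M :: nat \<Rightarrow> 'i list. \<exists>\<chi> :: nat \<Rightarrow> 'i fm.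
       (\<forall>j\<in>{1..n}. M j \<in> blocks I \<and> \<chi> j \<in> \<Delta>) \<and>
       L \<Gamma> (fm_prod (map (\<lambda>j. apply_block (M j) (\<chi> j)) [1..<Suc n]) \<^bold>\<rightarrow> \<psi>))"
proof -
  obtain S where S: "S \<subseteq> formulas I" "L = derives I S"
    using assms(1) by (auto simp: axiomatic_extension_def)
  \<comment> \<open>Algebraization by a class of MV-algebras enters here, supplying
    \<open>One\<close>.\<close>
  interpret unital_extension I S
    using S assms(2,3) by unfold_locales (auto intro: algebraized_derives_One)
  have formulas: "\<Gamma> \<subseteq> formulas I" "\<Delta> \<subseteq> formulas I"
    using assms(4) by auto
  show ?thesis
    unfolding S(2) deduction_iff[OF formulas] list_of_images_iff by blast
qed

end
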